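(* Let $n\geq 8$ be an integer. (i) For every $i$, the number $d_{coe}(P_n,i)$ of co-even dominating sets of the path $P_n$ with cardinality $i$ satisfies $$d_{coe}(P_n,i)=d(P_{n-2},i-2)+2d_{coe}(P_{n-4},i-2)+2d_{coe}(P_{n-5},i-2)+d_{coe}(P_{n-6},i-2).$$ (ii) The generating function of co-even dominating sets of $P_n$ satisfies $$D_{coe}(P_n,x)=x^2\Big(D(P_{n-2},x)+2D_{coe}(P_{n-4},x)+2D_{coe}(P_{n-5},x)+D_{coe}(P_{n-6},x)\Big).$$
   Context: $P_m$ denotes the path graph on $m$ vertices. For a finite simple graph $G=(V,E)$, a set $D\subseteq V$ is a dominating set if every vertex of $V-D$ is adjacent to at least one vertex of $D$; a dominating set $D$ is a co-even dominating set if the degree in $G$ of every vertex of $V-D$ is even. $d(G,i)$ denotes the number of dominating sets of $G$ of cardinality $i$, and $d_{coe}(G,i)$ the number of co-even dominating sets of $G$ of cardinality $i$ (both are $0$ when $i$ is negative). The generating functions are $D(G,x)=\sum_{i=1}^{|V|}d(G,i)x^i$ and $D_{coe}(G,x)=\sum_{i=1}^{|V|}d_{coe}(G,i)x^i$. *)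

theory Defs
  imports "Graph_Theory.Pair_Digraph" "HOL-Computational_Algebra.Polynomial"
begin

text \<open>
  As in \<^theory>\<open>Graph_Theory.Digraph\<close>, a finite simple graph is a finite loop-free symmetric
  digraph without parallel arcs (locale \<^locale>\<open>pair_graph\<close>): an undirected edge
  between u and v is the pair of arcs (u,v), (v,u), so that the degree of a vertex is its
  out-degree.
\<close>

definition path_graph :: "nat \<Rightarrow> nat pair_pre_digraph" where
  "path_graph m = \<lparr> pverts = {1..m},
     parcs = {(u, v). u \<in> {1..m} \<and> v \<in> {1..m} \<and> (v = Suc u \<or> u = Suc v)} \<rparr>"

lemma pair_graph_path_graph: "pair_graph (path_graph m)"
proof unfold_locales
  show "finite (parcs (path_graph m))"
    by (rule finite_subset[of _ "{1..m} \<times> {1..m}"]) (auto simp: path_graph_def)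
  show "symmetric (with_proj (path_graph m))"
    by (auto simp: symmetric_def sym_def path_graph_def)
qed (auto simp: path_graph_def)

definition dominating_set :: "'a pair_pre_digraph \<Rightarrow> 'a set \<Rightarrow> bool" where
  "dominating_set G D \<longleftrightarrow>
     D \<subseteq> pverts G \<and> (\<forall>v \<in> pverts G - D. \<exists>u \<in> D. v \<rightarrow>\<^bsub>with_proj G\<^esub> u)"

definition coeven_dominating_set :: "'a pair_pre_digraph \<Rightarrow> 'a set \<Rightarrow> bool" where
  "coeven_dominating_set G D \<longleftrightarrow>
     dominating_set G D \<and> (\<forall>v \<in> pverts G - D. even (out_degree (with_proj G) v))"

text \<open>
  The cardinality is an integer, so that both numbers are 0 for negative i.
\<close>

definition dom_count :: "'a pair_pre_digraph \<Rightarrow> int \<Rightarrow> nat" where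
  "dom_count G i = card {D. dominating_set G D \<and> int (card D) = i}"

definition coeven_dom_count :: "'a pair_pre_digraph \<Rightarrow> int \<Rightarrow> nat" where
  "coeven_dom_count G i = card {D. coeven_dominating_set G D \<and> int (card D) = i}"

definition dom_poly :: "'a pair_pre_digraph \<Rightarrow> int poly" where
  "dom_poly G = (\<Sum>i = 1..card (pverts G). monom (int (dom_count G (int i))) i)"

definition coeven_dom_poly :: "'a pair_pre_digraph \<Rightarrow> int poly" where
  "coeven_dom_poly G = (\<Sum>i = 1..card (pverts G). monom (int (coeven_dom_count G (int i))) i)"

end

theory Submission
  imports Defs
begin

text \<open>
  The end vertices of a path are its only vertices of odd degree, so a co-even dominating set
  of \<open>P\<^sub>n\<close> contains 1 and n, and leaves gaps of length at most 2 between consecutive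
  elements. Deleting 1 and n leaves a dominating set of \<open>P\<^sub>n\<^sub>-\<^sub>2\<close> unless the first or the last gap
  has length exactly 2; in that case, deleting both end vertices together with the first and
  the last gap leaves a co-even dominating set of a shorter path. The five pairs of gap lengths
  (2,0), (0,2), (2,1), (1,2), (2,2) give the remaining terms.
\<close>

section \<open>Domination and parity of degrees in paths\<close>

text \<open>The ends of the path need no separate clause: for \<open>v = 1\<close> and
  \<open>v = m\<close> the values \<open>v - 1 = 0\<close> and \<open>Suc v = m + 1\<close> lie
  outside \<open>{1..m}\<close>, hence outside \<open>D\<close>.\<close>

lemma dominating_set_path_iff:
  "dominating_set (path_graph m) D \<longleftrightarrow>
     D \<subseteq> {1..m} \<and> (\<forall>v \<in> {1..m} - D. v - 1 \<in> D \<or> Suc v \<in> D)"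
proof (cases "D \<subseteq> {1..m}")
  case True
  have "(\<exists>u\<in>D. v \<rightarrow>\<^bsub>with_proj (path_graph m)\<^esub> u) \<longleftrightarrow> v - 1 \<in> D \<or> Suc v \<in> D"
    if "v \<in> {1..m} - D" for v
  proof -
    have "(v, u) \<in> parcs (path_graph m) \<longleftrightarrow> u = v - 1 \<or> u = Suc v" if "u \<in> D" for u
    proof -
      have "u \<in> {1..m}"
        using True that by blast
      then show ?thesis
        using \<open>v \<in> {1..m} - D\<close> that by (auto simp: path_graph_def)
    qed
    then show ?thesis
      by auto
  qed
  then show ?thesis
    using True by (auto simp: dominating_set_def path_graph_def)
qed (simp add: dominating_set_def path_graph_def)

lemma out_degree_path:
  "out_degree (with_proj (path_graph m)) v =
     card {u \<in> {1..m}. v \<in> {1..m} \<and> (u = Suc v \<or> v = Suc u)}"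
proof -
  have "out_arcs (with_proj (path_graph m)) v =
      Pair v ` {u \<in> {1..m}. v \<in> {1..m} \<and> (u = Suc v \<or> v = Suc u)}"
    by (auto simp: out_arcs_def path_graph_def)
  then show ?thesis
    by (simp add: out_degree_def card_image inj_on_def)
qed

text \<open>An end vertex has one neighbour and an inner vertex has two. The bound
  \<open>m \<ge> 2\<close> excludes the one-vertex path, whose only vertex has the even degree
  0.\<close>

lemma even_out_degree_path_iff:
  assumes "m \<ge> 2" and "v \<in> {1..m}"
  shows "even (out_degree (with_proj (path_graph m)) v) \<longleftrightarrow> v \<noteq> 1 \<and> v \<noteq> m"
proof -
  have "{u \<in> {1..m}. v \<in> {1..m} \<and> (u = Suc v \<or> v = Suc u)} =
      (if v = 1 then {2} else if v = m then {m - 1} else {v - 1, Suc v})"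
    using assms by auto
  then show ?thesis
    unfolding out_degree_path by simp
qed

lemma coeven_dominating_set_path_iff:
  assumes "m \<ge> 2"
  shows "coeven_dominating_set (path_graph m) D \<longleftrightarrow>
     dominating_set (path_graph m) D \<and> 1 \<in> D \<and> m \<in> D"
proof -
  have "(\<forall>v\<in>pverts (path_graph m) - D. even (out_degree (with_proj (path_graph m)) v)) \<longleftrightarrow>
      1 \<in> D \<and> m \<in> D"
    using assms even_out_degree_path_iff[OF assms] by (auto simp: path_graph_def)
  then show ?thesis
    by (simp add: coeven_dominating_set_def)
qed

section \<open>Shifting a set and adding the end vertices\<close>

text \<open>This reverses the deletion: a set in the path on \<open>m\<close> vertices is moved to
  \<open>k + 1, ..., k + m\<close> and receives the ends 1 and \<open>n\<close>. If it contains 1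
  and \<open>m\<close>, the first gap of the result has length \<open>k - 1\<close> and the last one
  \<open>n - k - m - 1\<close>.\<close>

definition shift_extend :: "nat \<Rightarrow> nat \<Rightarrow> nat set \<Rightarrow> nat set" where
  "shift_extend n k D = insert 1 (insert n ((+) k ` D))"

lemma mem_shift_extend_iff:
  "x \<in> shift_extend n k D \<longleftrightarrow> x = 1 \<or> x = n \<or> (k \<le> x \<and> x - k \<in> D)"
  by (auto simp: shift_extend_def image_iff le_iff_add)

lemma card_shift_extend:
  assumes "D \<subseteq> {1..m}" and "k \<ge> 1" and "k + m < n"
  shows "card (shift_extend n k D) = card D + 2"
proof -
  have "finite D"
    using assms(1) finite_subset by blast
  moreover have "1 \<notin> (+) k ` D" "n \<notin> (+) k ` D" "n \<noteq> 1"
    using assms by auto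
  ultimately show ?thesis
    by (simp add: shift_extend_def card_image)
qed

lemma inj_on_shift_extend:
  assumes "k \<ge> 1" and "k + m < n"
  shows "inj_on (shift_extend n k) (Pow {1..m})"
proof (rule inj_on_inverseI[where g = "\<lambda>E. {x \<in> {1..m}. k + x \<in> E}"])
  show "{x \<in> {1..m}. k + x \<in> shift_extend n k D} = D" if "D \<in> Pow {1..m}" for D
    using that assms by (auto simp: mem_shift_extend_iff)
qed

text \<open>The common counting scheme: \<open>shift_extend n k\<close> is a bijection that raises
  the cardinality by 2. The condition on \<open>Q\<close> confines \<open>E\<close> to the range of
  this map, so that each application is left with the equivalence of \<open>Q\<close> and
  \<open>P\<close>.\<close>

lemma card_eq_shift_extend:
  fixes i :: int
  assumes k: "k \<ge> 1" "k + m < n"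
    and P: "\<And>D. P D \<Longrightarrow> D \<subseteq> {1..m}"
    and Q: "\<And>E. Q E \<Longrightarrow> 1 \<in> E \<and> n \<in> E \<and> E \<subseteq> {1, n} \<union> {k + 1..k + m}"
    and PQ: "\<And>D. D \<subseteq> {1..m} \<Longrightarrow> Q (shift_extend n k D) \<longleftrightarrow> P D"
  shows "card {E. Q E \<and> int (card E) = i} = card {D. P D \<and> int (card D) = i - 2}"
proof -
  have "{E. Q E \<and> int (card E) = i} = shift_extend n k ` {D. P D \<and> int (card D) = i - 2}"
  proof (intro subset_antisym subsetI)
    fix E assume E: "E \<in> {E. Q E \<and> int (card E) = i}"
    define D where "D = {x \<in> {1..m}. k + x \<in> E}"
    have D: "D \<subseteq> {1..m}"
      by (auto simp: D_def)
    have QE: "1 \<in> E" "n \<in> E" "E \<subseteq> {1, n} \<union> {k + 1..k + m}"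
      using E Q by auto
    have "E = shift_extend n k D"
    proof (rule set_eqI)
      fix x
      have "x = 1 \<or> x = n \<or> x \<in> {k + 1..k + m}" if "x \<in> E"
        using that QE(3) by blast
      then show "x \<in> E \<longleftrightarrow> x \<in> shift_extend n k D"
        using QE(1,2) by (auto simp: mem_shift_extend_iff D_def)
    qed
    moreover from this have "P D" "int (card D) = i - 2"
      using E PQ[OF D] card_shift_extend[OF D k] by auto
    ultimately show "E \<in> shift_extend n k ` {D. P D \<and> int (card D) = i - 2}"
      by blast
  next
    fix E assume "E \<in> shift_extend n k ` {D. P D \<and> int (card D) = i - 2}"
    then obtain D where D: "E = shift_extend n k D" "P D" "int (card D) = i - 2"
      by blast
    then show "E \<in> {E. Q E \<and> int (card E) = i}"
      using PQ[OF P] card_shift_extend[OF P k] by simp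
  qed
  moreover have "inj_on (shift_extend n k) {D. P D \<and> int (card D) = i - 2}"
    by (rule inj_on_subset[OF inj_on_shift_extend[OF k]]) (use P in auto)
  ultimately show ?thesis
    by (simp add: card_image)
qed

lemma ball_interval_shift_iff:
  fixes k m :: nat
  shows "(\<forall>v\<in>{k + 1..k + m}. R v) \<longleftrightarrow> (\<forall>v\<in>{1..m}. R (k + v))"
proof -
  have "{k + 1..k + m} = (+) k ` {1..m}"
    by simp
  then show ?thesis
    by (metis image_eqI imageE)
qed

section \<open>Counting sets with prescribed end gaps\<close>

text \<open>The bounds on \<open>k\<close> and \<open>n\<close> say that both end gaps have length
  at most 2. Every vertex in such a gap is adjacent to a boundary element of the gap, so domination
  only has to be checked on the shifted copy of the shorter path.\<close>

lemma card_coeven_with_short_gaps: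
  fixes i :: int
  assumes "m \<ge> 2" and "1 \<le> k" "k \<le> 3" and "k + m < n" "n \<le> k + m + 3"
  shows "card {E. (coeven_dominating_set (path_graph n) E
             \<and> k + 1 \<in> E \<and> k + m \<in> E \<and> E \<subseteq> {1, n} \<union> {k + 1..k + m}) \<and> int (card E) = i} =
         coeven_dom_count (path_graph m) (i - 2)"
  unfolding coeven_dom_count_def
proof (rule card_eq_shift_extend[where k = k and n = n and m = m])
  fix D assume D: "D \<subseteq> {1..m}"
  let ?E = "shift_extend n k D"
  have mem: "k + x \<in> ?E \<longleftrightarrow> x \<in> D" if "x \<in> {1..m}" for x
    using that assms by (auto simp: mem_shift_extend_iff)
  have ends: "k + 1 \<in> ?E \<longleftrightarrow> 1 \<in> D" "k + m \<in> ?E \<longleftrightarrow> m \<in> D"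
    using mem[of 1] mem[of m] assms by auto
  have sub: "?E \<subseteq> {1, n} \<union> {k + 1..k + m}" "?E \<subseteq> {1..n}" "1 \<in> ?E" "n \<in> ?E"
    using D assms by (auto simp: shift_extend_def)
  have "(\<forall>v\<in>{1..n} - ?E. v - 1 \<in> ?E \<or> Suc v \<in> ?E) \<longleftrightarrow>
        (\<forall>v\<in>{1..m} - D. v - 1 \<in> D \<or> Suc v \<in> D)" if in_D: "1 \<in> D" "m \<in> D"
  proof -
    \<comment> \<open>Outside the copy, \<open>v\<close> is next to one of 1, \<open>k + 1\<close>,
      \<open>k + m\<close>, \<open>n\<close>, all of which belong to the extended set.\<close>
    have outer: "v - 1 \<in> ?E \<or> Suc v \<in> ?E"
      if v: "v \<in> {1..n} - ?E" "v \<notin> {k + 1..k + m}" for v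
    proof -
      have "v \<noteq> 1" "v \<noteq> n" using v sub by auto
      then have "v = 2 \<or> Suc v = k + 1 \<or> v = k + m + 1 \<or> Suc v = n"
        using v assms by auto
      then show ?thesis
        using ends in_D sub(3,4) by auto
    qed
    have "(\<forall>v\<in>{1..n} - ?E. v - 1 \<in> ?E \<or> Suc v \<in> ?E) \<longleftrightarrow>
        (\<forall>v\<in>{k + 1..k + m}. v \<in> ?E \<or> v - 1 \<in> ?E \<or> Suc v \<in> ?E)"
    proof -
      have "{k + 1..k + m} \<subseteq> {1..n}" using assms by auto
      then show ?thesis using outer by blast
    qed
    also have "\<dots> \<longleftrightarrow> (\<forall>v\<in>{1..m}. k + v \<in> ?E \<or> k + v - 1 \<in> ?E \<or> Suc (k + v) \<in> ?E)"
      by (rule ball_interval_shift_iff)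
    also have "\<dots> \<longleftrightarrow> (\<forall>v\<in>{1..m}. v \<in> D \<or> v - 1 \<in> D \<or> Suc v \<in> D)"
    proof (rule ball_cong[OF refl])
      fix v assume v: "v \<in> {1..m}"
      show "(k + v \<in> ?E \<or> k + v - 1 \<in> ?E \<or> Suc (k + v) \<in> ?E) \<longleftrightarrow>
          (v \<in> D \<or> v - 1 \<in> D \<or> Suc v \<in> D)"
      \<comment> \<open>The ends of the copy belong to \<open>D\<close> and satisfy both sides at
        once. Only for inner \<open>v\<close> do both neighbours stay in \<open>{1..m}\<close>,
        where \<open>mem\<close> applies.\<close>
      proof (cases "v = 1 \<or> v = m")
        case True
        then show ?thesis using ends in_D by auto
      next
        case False
        then have "k + (v - 1) = k + v - 1" "v - 1 \<in> {1..m}" "Suc v \<in> {1..m}"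
          using v by auto
        then show ?thesis
          using mem[OF v] mem[of "v - 1"] mem[of "Suc v"] by simp
      qed
    qed
    finally show ?thesis by blast
  qed
  moreover have "n \<ge> 2" using assms by simp
  ultimately show "(coeven_dominating_set (path_graph n) ?E \<and> k + 1 \<in> ?E \<and> k + m \<in> ?E
        \<and> ?E \<subseteq> {1, n} \<union> {k + 1..k + m}) \<longleftrightarrow> coeven_dominating_set (path_graph m) D"
    unfolding coeven_dominating_set_path_iff[OF \<open>m \<ge> 2\<close>]
      coeven_dominating_set_path_iff[OF \<open>n \<ge> 2\<close>] dominating_set_path_iff ends
    using D sub by blast
qed (use assms in \<open>auto simp: coeven_dominating_set_path_iff dominating_set_path_iff\<close>)

text \<open>In the long path, 2 and \<open>m + 1\<close> are dominated by the end vertices. After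
  deletion of the ends they must be dominated from within; the two disjunctions demand exactly this,
  and they say that neither end gap has length 2.\<close>

lemma card_coeven_eq_dom_count:
  fixes i :: int
  assumes "m \<ge> 2"
  shows "card {E. (coeven_dominating_set (path_graph (m + 2)) E
             \<and> (2 \<in> E \<or> 3 \<in> E) \<and> (m + 1 \<in> E \<or> m \<in> E)) \<and> int (card E) = i} =
         dom_count (path_graph m) (i - 2)"
  unfolding dom_count_def
proof (rule card_eq_shift_extend[where k = 1 and n = "m + 2" and m = m])
  fix D assume D: "D \<subseteq> {1..m}"
  let ?E = "shift_extend (m + 2) 1 D"
  have mem: "Suc x \<in> ?E \<longleftrightarrow> x \<in> D" if "x \<in> {1..m}" for x
    using that by (auto simp: mem_shift_extend_iff)
  have sub: "?E \<subseteq> {1..m + 2}" "1 \<in> ?E" "m + 2 \<in> ?E"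
    using D by (auto simp: shift_extend_def)
  have ends: "2 \<in> ?E \<longleftrightarrow> 1 \<in> D" "3 \<in> ?E \<longleftrightarrow> 2 \<in> D" "m + 1 \<in> ?E \<longleftrightarrow> m \<in> D" "m \<in> ?E \<longleftrightarrow> m - 1 \<in> D"
    using mem[of 1] mem[of 2] mem[of m] mem[of "m - 1"] assms
    by (auto simp: numeral_2_eq_2 numeral_3_eq_3 mem_shift_extend_iff)
  have "(\<forall>v\<in>{1..m + 2} - ?E. v - 1 \<in> ?E \<or> Suc v \<in> ?E) \<and> (1 \<in> D \<or> 2 \<in> D) \<and> (m \<in> D \<or> m - 1 \<in> D)
      \<longleftrightarrow> (\<forall>v\<in>{1..m} - D. v - 1 \<in> D \<or> Suc v \<in> D)"
  proof -
    have "{1..m + 2} = insert 1 (insert (m + 2) {1 + 1..1 + m})"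
      by auto
    then have "(\<forall>v\<in>{1..m + 2} - ?E. v - 1 \<in> ?E \<or> Suc v \<in> ?E) \<longleftrightarrow>
        (\<forall>v\<in>{1 + 1..1 + m}. v \<in> ?E \<or> v - 1 \<in> ?E \<or> Suc v \<in> ?E)"
      using sub by auto
    also have "\<dots> \<longleftrightarrow> (\<forall>v\<in>{1..m}. 1 + v \<in> ?E \<or> 1 + v - 1 \<in> ?E \<or> Suc (1 + v) \<in> ?E)"
      by (rule ball_interval_shift_iff)
    \<comment> \<open>The exceptions \<open>v = 1\<close> and \<open>v = m\<close> arise because
      these vertices are shifted to the neighbours of the added ends.\<close>
    also have "\<dots> \<longleftrightarrow> (\<forall>v\<in>{1..m}. v \<in> D \<or> v = 1 \<or> v = m \<or> v - 1 \<in> D \<or> Suc v \<in> D)"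
    proof (rule ball_cong[OF refl])
      fix v assume v: "v \<in> {1..m}"
      show "(1 + v \<in> ?E \<or> 1 + v - 1 \<in> ?E \<or> Suc (1 + v) \<in> ?E) \<longleftrightarrow>
          (v \<in> D \<or> v = 1 \<or> v = m \<or> v - 1 \<in> D \<or> Suc v \<in> D)"
      proof (cases "v = 1 \<or> v = m")
        case True
        then show ?thesis using sub(2,3) by auto
      next
        case False
        then have "Suc (v - 1) = v" "v - 1 \<in> {1..m}" "Suc v \<in> {1..m}"
          using v by auto
        then show ?thesis
          using False mem[OF v] mem[of "v - 1"] mem[of "Suc v"] by auto
      qed
    qed
    finally have "(\<forall>v\<in>{1..m + 2} - ?E. v - 1 \<in> ?E \<or> Suc v \<in> ?E) \<longleftrightarrow>
        (\<forall>v\<in>{1..m}. v \<in> D \<or> v = 1 \<or> v = m \<or> v - 1 \<in> D \<or> Suc v \<in> D)" .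
    \<comment> \<open>As 0 and \<open>Suc m\<close> are not in \<open>D\<close>, domination at
      \<open>v = 1\<close> and \<open>v = m\<close> amounts to the two disjunctions, which fill in
      the exceptions.\<close>
    moreover have "1 - 1 \<notin> D" "Suc m \<notin> D" "Suc 1 = 2" "1 \<in> {1..m}" "m \<in> {1..m}"
      using D assms by auto
    ultimately show ?thesis
      by (smt (verit, best) Diff_iff)
  qed
  then show "(coeven_dominating_set (path_graph (m + 2)) ?E \<and> (2 \<in> ?E \<or> 3 \<in> ?E)
        \<and> (m + 1 \<in> ?E \<or> m \<in> ?E)) \<longleftrightarrow> dominating_set (path_graph m) D"
    unfolding coeven_dominating_set_path_iff[OF le_add2] dominating_set_path_iff ends
    using D sub by blast
qed (auto simp: coeven_dominating_set_path_iff dominating_set_path_iff)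

section \<open>The recurrence for the counts\<close>

lemma finite_dominating_sets_path: "finite {D. dominating_set (path_graph m) D}"
  by (rule finite_subset[of _ "Pow {1..m}"]) (auto simp: dominating_set_path_iff)

lemma coeven_dom_count_path:
  fixes i :: int
  assumes n: "n \<ge> 8"
  shows "coeven_dom_count (path_graph n) i =
            dom_count (path_graph (n - 2)) (i - 2)
            + 2 * coeven_dom_count (path_graph (n - 4)) (i - 2)
            + 2 * coeven_dom_count (path_graph (n - 5)) (i - 2)
            + coeven_dom_count (path_graph (n - 6)) (i - 2)"
proof -
  let ?C = "\<lambda>E. coeven_dominating_set (path_graph n) E"
  let ?S = "\<lambda>P. {E. (?C E \<and> P E) \<and> int (card E) = i}"
  \<comment> \<open>\<open>A\<close> collects the sets with no end gap of length 2;
    \<open>B k m\<close> collects those with end gaps of lengths \<open>k - 1\<close> and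
    \<open>n - k - m - 1\<close>.\<close>
  define A where "A = ?S (\<lambda>E. (2 \<in> E \<or> 3 \<in> E) \<and> (n - 1 \<in> E \<or> n - 2 \<in> E))"
  define B where "B k m = ?S (\<lambda>E. k + 1 \<in> E \<and> k + m \<in> E \<and> E \<subseteq> {1, n} \<union> {k + 1..k + m})"
    for k m
  have dom: "E \<subseteq> {1..n}" "1 \<in> E" "n \<in> E" "2 \<in> E \<or> 3 \<in> E \<or> 4 \<in> E"
    "n - 1 \<in> E \<or> n - 2 \<in> E \<or> n - 3 \<in> E" if "?C E" for E
  proof -
    have *: "E \<subseteq> {1..n}" "1 \<in> E" "n \<in> E" "\<And>v. v \<in> {1..n} - E \<Longrightarrow> v - 1 \<in> E \<or> Suc v \<in> E"
      using that n by (simp_all add: coeven_dominating_set_path_iff dominating_set_path_iff)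
    show "E \<subseteq> {1..n}" "1 \<in> E" "n \<in> E" by fact+
    \<comment> \<open>Vertex 3, if absent, needs 2 or 4 as a dominator, so the first gap has length
      at most 2; vertex \<open>n - 2\<close> plays this role at the other end.\<close>
    show "2 \<in> E \<or> 3 \<in> E \<or> 4 \<in> E"
      using *(4)[of 3] n by (auto simp: eval_nat_numeral)
    have "Suc (n - 2) = n - 1" "n - 2 - 1 = n - 3"
      using n by auto
    moreover have "n - 2 \<in> {1..n}"
      using n by auto
    ultimately show "n - 1 \<in> E \<or> n - 2 \<in> E \<or> n - 3 \<in> E"
      using *(4)[of "n - 2"] by (metis DiffI)
  qed
  have fin: "finite (?S P)" for P
    by (rule finite_subset[OF _ finite_dominating_sets_path[of n]])
      (auto simp: coeven_dominating_set_def)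
  \<comment> \<open>The gap pairs are (2,0), (0,2), (2,1), (1,2), (2,2), in this order. Expressed by
    membership of 2, 3, \<open>n - 1\<close> and \<open>n - 2\<close>, the classes are visibly
    disjoint from each other and from \<open>A\<close>, and together with \<open>A\<close> they
    exhaust all cases.\<close>
  have B_eq:
    "B 3 (n - 4) = ?S (\<lambda>E. 2 \<notin> E \<and> 3 \<notin> E \<and> n - 1 \<in> E)"
    "B 1 (n - 4) = ?S (\<lambda>E. 2 \<in> E \<and> n - 1 \<notin> E \<and> n - 2 \<notin> E)"
    "B 3 (n - 5) = ?S (\<lambda>E. 2 \<notin> E \<and> 3 \<notin> E \<and> n - 1 \<notin> E \<and> n - 2 \<in> E)"
    "B 2 (n - 5) = ?S (\<lambda>E. 2 \<notin> E \<and> 3 \<in> E \<and> n - 1 \<notin> E \<and> n - 2 \<notin> E)"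
    "B 3 (n - 6) = ?S (\<lambda>E. 2 \<notin> E \<and> 3 \<notin> E \<and> n - 1 \<notin> E \<and> n - 2 \<notin> E)"
  proof -
    obtain p where p: "n = p + 8" using n le_Suc_ex by (metis add.commute)
    \<comment> \<open>Containment becomes disjointness from the two end gaps, which are explicit
      intervals of at most two elements in each of the five cases.\<close>
    have sub: "E \<subseteq> {1, n} \<union> {k + 1..k + m} \<longleftrightarrow>
        E \<inter> ({2..k} \<union> {k + m + 1..n - 1}) = {}" if "?C E" "k \<ge> 1" "k + m < n" for E k m
    proof -
      have "{1..n} = {1, n} \<union> {k + 1..k + m} \<union> ({2..k} \<union> {k + m + 1..n - 1})"
        "({1, n} \<union> {k + 1..k + m}) \<inter> ({2..k} \<union> {k + m + 1..n - 1}) = {}"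
        using that by auto
      then show ?thesis
        using dom(1)[OF that(1)] by blast
    qed
    have ivl: "{2..1} = ({} :: nat set)" "{2..2} = {2 :: nat}" "{2..3} = {2, 3 :: nat}"
      "{6 + p..7 + p} = {6 + p, 7 + p}" "Suc (Suc 0) = 2"
      by auto
    have split: "B k m = ?S P"
      if "\<And>E. 2 \<in> E \<or> 3 \<in> E \<or> 4 \<in> E \<Longrightarrow>
           n - 1 \<in> E \<or> n - 2 \<in> E \<or> n - 3 \<in> E \<Longrightarrow> (k + 1 \<in> E \<and> k + m \<in> E \<and>
             E \<inter> ({2..k} \<union> {k + m + 1..n - 1}) = {}) = P E" "k \<ge> 1" "k + m < n" for k m P
      unfolding B_def using that(1)[OF dom(4,5)] sub[OF _ that(2,3)] by blast
    show "B 3 (n - 4) = ?S (\<lambda>E. 2 \<notin> E \<and> 3 \<notin> E \<and> n - 1 \<in> E)"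
      by (rule split) (use p in \<open>auto simp: ivl\<close>)
    show "B 1 (n - 4) = ?S (\<lambda>E. 2 \<in> E \<and> n - 1 \<notin> E \<and> n - 2 \<notin> E)"
      by (rule split) (use p in \<open>auto simp: ivl\<close>)
    show "B 3 (n - 5) = ?S (\<lambda>E. 2 \<notin> E \<and> 3 \<notin> E \<and> n - 1 \<notin> E \<and> n - 2 \<in> E)"
      by (rule split) (use p in \<open>auto simp: ivl\<close>)
    show "B 2 (n - 5) = ?S (\<lambda>E. 2 \<notin> E \<and> 3 \<in> E \<and> n - 1 \<notin> E \<and> n - 2 \<notin> E)"
      by (rule split) (use p in \<open>auto simp: ivl\<close>)
    show "B 3 (n - 6) = ?S (\<lambda>E. 2 \<notin> E \<and> 3 \<notin> E \<and> n - 1 \<notin> E \<and> n - 2 \<notin> E)"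
      by (rule split) (use p in \<open>auto simp: ivl\<close>)
  qed
  have "{E. ?C E \<and> int (card E) = i} =
      A \<union> (B 3 (n - 4) \<union> (B 1 (n - 4) \<union> (B 3 (n - 5) \<union> (B 2 (n - 5) \<union> B 3 (n - 6)))))"
    unfolding A_def B_eq by blast
  also have "card \<dots> = card A + (card (B 3 (n - 4)) + (card (B 1 (n - 4)) +
      (card (B 3 (n - 5)) + (card (B 2 (n - 5)) + card (B 3 (n - 6))))))"
  proof -
    have "A \<inter> (B 3 (n - 4) \<union> (B 1 (n - 4) \<union> (B 3 (n - 5) \<union> (B 2 (n - 5) \<union> B 3 (n - 6))))) = {}"
      "B 3 (n - 4) \<inter> (B 1 (n - 4) \<union> (B 3 (n - 5) \<union> (B 2 (n - 5) \<union> B 3 (n - 6)))) = {}"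
      "B 1 (n - 4) \<inter> (B 3 (n - 5) \<union> (B 2 (n - 5) \<union> B 3 (n - 6))) = {}"
      "B 3 (n - 5) \<inter> (B 2 (n - 5) \<union> B 3 (n - 6)) = {}"
      "B 2 (n - 5) \<inter> B 3 (n - 6) = {}"
      unfolding A_def B_eq by blast+
    moreover have "finite A" "finite (B k m)" for k m
      unfolding A_def B_def by (rule fin)+
    ultimately show ?thesis
      by (simp add: card_Un_disjoint)
  qed
  also have "card A = dom_count (path_graph (n - 2)) (i - 2)"
  proof -
    have "n - 2 + 2 = n" "n - 2 + 1 = n - 1" using n by auto
    then show ?thesis
      using card_coeven_eq_dom_count[of "n - 2" i] n unfolding A_def by simp
  qed
  \<comment> \<open>For the smallest path, on \<open>n - 6\<close> vertices, the condition
    \<open>m \<ge> 2\<close> is supplied by \<open>n \<ge> 8\<close>.\<close>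
  moreover have "card (B k m) = coeven_dom_count (path_graph m) (i - 2)"
    if "m \<ge> 2" "1 \<le> k" "k \<le> 3" "k + m < n" "n \<le> k + m + 3" for k m
    unfolding B_def using that by (rule card_coeven_with_short_gaps)
  ultimately show ?thesis
    using n by (simp add: coeven_dom_count_def)
qed

section \<open>Generating functions\<close>

text \<open>The sum omits degree 0 and degrees above \<open>m\<close>, but no nonempty subset of
  \<open>{1..m}\<close> has such a cardinality. Coefficients and counts therefore agree for every
  \<open>k\<close>.\<close>

lemma coeff_sum_monom_int_count:
  fixes F :: "nat set \<Rightarrow> bool"
  assumes F: "\<And>D. F D \<Longrightarrow> D \<subseteq> {1..m} \<and> D \<noteq> {}"
  shows "coeff (\<Sum>j = 1..m. monom (int (card {D. F D \<and> int (card D) = int j})) j) k =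
    int (card {D. F D \<and> int (card D) = int k})"
proof -
  have "card {D. F D \<and> int (card D) = int k} = 0" if "k \<notin> {1..m}"
  proof -
    have "card D \<in> {1..m}" if "F D" for D
    proof -
      have "finite D" "D \<noteq> {}"
        using F[OF that] finite_subset by blast+
      moreover have "card D \<le> m"
        using card_mono[of "{1..m}" D] F[OF that] by simp
      ultimately show ?thesis
        by (simp add: Suc_le_eq card_gt_0_iff)
    qed
    then have "{D. F D \<and> int (card D) = int k} = {}"
      using that by auto
    then show ?thesis
      by (simp only: card.empty)
  qed
  then show ?thesis
    by (simp add: coeff_sum coeff_monom)
qed

text \<open>Vertex 1 must be dominated. In \<open>path_graph 0\<close> the empty set is dominating,
  which \<open>m \<ge> 1\<close> rules out.\<close>

lemma dominating_set_path_nonempty: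
  assumes "m \<ge> 1" and "dominating_set (path_graph m) D"
  shows "D \<subseteq> {1..m} \<and> D \<noteq> {}"
  using assms by (auto simp: dominating_set_path_iff)

lemma coeff_dom_poly_path:
  assumes "m \<ge> 1"
  shows "coeff (dom_poly (path_graph m)) k = int (dom_count (path_graph m) (int k))"
proof -
  have "card (pverts (path_graph m)) = m"
    by (simp add: path_graph_def)
  then show ?thesis
    using coeff_sum_monom_int_count[OF dominating_set_path_nonempty[OF assms]]
    by (simp add: dom_poly_def dom_count_def)
qed

lemma coeff_coeven_dom_poly_path:
  assumes "m \<ge> 1"
  shows "coeff (coeven_dom_poly (path_graph m)) k = int (coeven_dom_count (path_graph m) (int k))"
proof -
  have "card (pverts (path_graph m)) = m"
    by (simp add: path_graph_def)
  moreover have "D \<subseteq> {1..m} \<and> D \<noteq> {}" if "coeven_dominating_set (path_graph m) D" for D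
    using that dominating_set_path_nonempty[OF assms] by (simp add: coeven_dominating_set_def)
  ultimately show ?thesis
    using coeff_sum_monom_int_count[of "coeven_dominating_set (path_graph m)" m]
    by (simp add: coeven_dom_poly_def coeven_dom_count_def)
qed

theorem theorem4p4:
  fixes n :: nat
  assumes "n \<ge> 8"
  shows "(\<forall>i::int. coeven_dom_count (path_graph n) i =
            dom_count (path_graph (n - 2)) (i - 2)
            + 2 * coeven_dom_count (path_graph (n - 4)) (i - 2)
            + 2 * coeven_dom_count (path_graph (n - 5)) (i - 2)
            + coeven_dom_count (path_graph (n - 6)) (i - 2))
       \<and> coeven_dom_poly (path_graph n) =
            monom 1 2 * (dom_poly (path_graph (n - 2))
            + 2 * coeven_dom_poly (path_graph (n - 4))
            + 2 * coeven_dom_poly (path_graph (n - 5))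
            + coeven_dom_poly (path_graph (n - 6)))"
proof (rule conjI[OF allI poly_eqI])
  fix k
  have coeff_double: "coeff (2 * p) j = 2 * coeff p j" for p :: "int poly" and j
    by (simp only: mult_2 coeff_add)
  \<comment> \<open>The factor \<open>monom 1 2\<close> makes the coefficients for
    \<open>k < 2\<close> vanish; in the recurrence these correspond to counts at the negative
    argument \<open>int k - 2\<close>.\<close>
  have negative: "dom_count G j = 0" "coeven_dom_count G j = 0" if "j < 0"
    for G :: "nat pair_pre_digraph" and j
    using that by (auto simp: dom_count_def coeven_dom_count_def)
  show "coeff (coeven_dom_poly (path_graph n)) k =
      coeff (monom 1 2 * (dom_poly (path_graph (n - 2))
            + 2 * coeven_dom_poly (path_graph (n - 4))
            + 2 * coeven_dom_poly (path_graph (n - 5))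
            + coeven_dom_poly (path_graph (n - 6)))) k"
    using assms coeven_dom_count_path[OF assms, of "int k"]
    by (auto simp: coeff_monom_mult coeff_double coeff_dom_poly_path coeff_coeven_dom_poly_path
        negative of_nat_diff)
qed (rule coeven_dom_count_path[OF assms])

end
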